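(* Let $N\in\mathbb{N}$, let $\mathfrak X=\{-N,\dots,N\}$, let $w$ be an even weight on $\mathfrak X$ with $w(x)>0$ for $x\ne0$ and $w(0)\ge 0$, and let $1\le n\le N-1$. With the notation of the context, on the subspace $\ell^2_0(\mathfrak X)$ the operator $$X\hat{\mathcal K}_{2n}X^{-1}-\mathcal K_{2n+2}$$ is represented by the kernel (for $x\in\mathfrak X$ and $y\in\mathfrak X\setminus\{0\}$) $$\frac{x}{2y}\,\mathfrak K_n^{(1)}(x,y)-\frac{1}{2\eta(x)}\,\mathfrak K_{n+1}^{(0)}(x,y)=-\frac{\sqrt{\beta_{2n+1}}}{y}\,p_{2n}(x)\,p_{2n+1}(y).$$ That is, for $f\in\ell^2_0(\mathfrak X)$ the operator maps $f$ to the function whose value at $x$ is the sum over $y\in\mathfrak X\setminus\{0\}$ of this kernel times $f(y)$. In particular, this operator has rank one. Moreover, if $w(0)=0$, the formula simplifies to $$\frac{x}{2y}\,\mathfrak K_n^{(1)}(x,y)-\frac{1}{2}\,\mathfrak K_{n+1}^{(0)}(x,y)=-\frac{\sqrt{\beta_{2n+1}}}{y}\,p_{2n}(x)\,p_{2n+1}(y).$$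
   Context: Functions on $\mathfrak X=\{-N,\dots,N\}$ form $\ell^2(\mathfrak X)$ with the standard inner product $\sum_{x\in\mathfrak X}f(x)g(x)$; $\ell^2_0(\mathfrak X)=\{f\in\ell^2(\mathfrak X): f(0)=0\}$. $P_m$ are the monic orthogonal polynomials with respect to $w$: $\deg P_m=m$, $\sum_{x\in\mathfrak X}P_m(x)P_\ell(x)w(x)=\delta_{m\ell}h_m^2$, $h_m>0$ (for $0\le m\le 2N$ if $w(0)>0$, and for $0\le m\le 2N-1$ if $w(0)=0$). The orthonormal functions are $p_m(x)=P_m(x)\sqrt{w(x)}/h_m$. The coefficients $\beta_m$ are defined by $xP_m(x)=P_{m+1}(x)+\beta_mP_{m-1}(x)$; equivalently $\beta_m=h_m^2/h_{m-1}^2$ for $m\ge1$. $\hat P_m$ ($0\le m\le 2N-1$) are the monic orthogonal polynomials on $\mathfrak X$ with respect to the weight $x^2w(x)$, with norms $\hat h_m>0$, $\hat h_m^2=\sum_{x}\hat P_m(x)^2x^2w(x)$, and $\hat p_m(x)=\hat P_m(x)\,x\sqrt{w(x)}/\hat h_m$; these form an orthonormal basis of $\ell^2_0(\mathfrak X)$. $\eta(x)=1$ for $x\ne0$ and $\eta(0)=1/\sqrt2$. For $x,y\in\mathfrak X$ the kernels are $$\mathfrak K_n^{(0)}(x,y)=2\eta(x)\eta(y)\sum_{\ell=0}^{n-1}p_{2\ell}(x)p_{2\ell}(y),\qquad \mathfrak K_n^{(1)}(x,y)=2\sum_{\ell=0}^{n-1}\hat p_{2\ell}(x)\hat p_{2\ell}(y).$$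 $\mathcal K_{2n}$ is the orthogonal projection in $\ell^2(\mathfrak X)$ onto the span of $p_0,p_2,\dots,p_{2n-2}$. $\hat{\mathcal K}_{2n}$ is the orthogonal projection in $\ell^2_0(\mathfrak X)$ onto the span of $\hat p_0,\hat p_2,\dots,\hat p_{2n-2}$. $X$ is the multiplication operator $(Xf)(x)=xf(x)$, which is invertible on $\ell^2_0(\mathfrak X)$. *)

theory Defs
  imports
    "HOL-Analysis.Analysis"
    "HOL-Computational_Algebra.Polynomial"
    "HOL-Library.Function_Algebras"
begin

text \<open>Pointwise scalar multiplication makes \<open>int \<Rightarrow> real\<close> a real vector space, so that the library's
  \<^const>\<open>span\<close> and \<^const>\<open>dim\<close> apply to functions on \<open>{-N..N}\<close>.\<close>

instantiation "fun" :: (type, real_vector) real_vector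
begin

definition scaleR_fun_def: "c *\<^sub>R f = (\<lambda>x. c *\<^sub>R f x)"

instance
  by standard (auto simp: scaleR_fun_def fun_eq_iff scaleR_add_right scaleR_add_left)

end

definition sites :: "nat \<Rightarrow> int set"
  where "sites N = {- int N .. int N}"

text \<open>Functions on \<open>{-N..N}\<close> are represented by functions on all integers that vanish outside
  \<open>{-N..N}\<close>.\<close>

definition ell2 :: "nat \<Rightarrow> (int \<Rightarrow> real) set"
  where "ell2 N = {f. \<forall>x. x \<notin> sites N \<longrightarrow> f x = 0}"

definition ell2_0 :: "nat \<Rightarrow> (int \<Rightarrow> real) set"
  where "ell2_0 N = {f \<in> ell2 N. f 0 = 0}"

definition ell2_inner :: "nat \<Rightarrow> (int \<Rightarrow> real) \<Rightarrow> (int \<Rightarrow> real) \<Rightarrow> real"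
  where "ell2_inner N f g = (\<Sum>x\<in>sites N. f x * g x)"

text \<open>The inner product of \<^term>\<open>ell2_0 N\<close> is that of \<^term>\<open>ell2 N\<close>, so for \<open>V \<subseteq> ell2_0 N\<close> the orthogonal
  projection of \<^term>\<open>ell2_0 N\<close> onto \<open>V\<close> is the restriction of the one defined here.\<close>

definition orth_proj :: "nat \<Rightarrow> (int \<Rightarrow> real) set \<Rightarrow> (int \<Rightarrow> real) \<Rightarrow> (int \<Rightarrow> real)"
  where "orth_proj N V f = (THE g. g \<in> V \<and> (\<forall>v\<in>V. ell2_inner N (f - g) v = 0))"

definition mult_X :: "(int \<Rightarrow> real) \<Rightarrow> (int \<Rightarrow> real)"
  where "mult_X f = (\<lambda>x. of_int x * f x)"

definition inv_X :: "nat \<Rightarrow> (int \<Rightarrow> real) \<Rightarrow> (int \<Rightarrow> real)"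
  where "inv_X N = inv_into (ell2_0 N) mult_X"

definition monic_OPs ::
  "int set \<Rightarrow> (int \<Rightarrow> real) \<Rightarrow> nat \<Rightarrow> (nat \<Rightarrow> real poly) \<Rightarrow> (nat \<Rightarrow> real) \<Rightarrow> bool"
  where "monic_OPs S u M P h \<longleftrightarrow>
    (\<forall>m\<le>M. degree (P m) = m \<and> lead_coeff (P m) = 1 \<and> h m > 0) \<and>
    (\<forall>m\<le>M. \<forall>l\<le>M. (\<Sum>x\<in>S. poly (P m) (of_int x) * poly (P l) (of_int x) * u x)
                     = (if m = l then (h m)\<^sup>2 else 0))"

text \<open>For an even weight this is the coefficient in the three-term recurrence; see
  \<open>three_term_recurrence\<close> below.\<close>

definition rec_coeff :: "(nat \<Rightarrow> real) \<Rightarrow> nat \<Rightarrow> real"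
  where "rec_coeff h m = (h m)\<^sup>2 / (h (m - 1))\<^sup>2"

definition orth_fun ::
  "nat \<Rightarrow> (int \<Rightarrow> real) \<Rightarrow> (nat \<Rightarrow> real poly) \<Rightarrow> (nat \<Rightarrow> real) \<Rightarrow> nat \<Rightarrow> int \<Rightarrow> real"
  where "orth_fun N w P h m =
    (\<lambda>x. if x \<in> sites N then poly (P m) (of_int x) * sqrt (w x) / h m else 0)"

text \<open>Note the factor \<open>x\<close>: the square root of the weight \<open>x\<^sup>2 w(x)\<close> would give \<open>\<bar>x\<bar>\<close> instead.\<close>

definition orth_fun_hat ::
  "nat \<Rightarrow> (int \<Rightarrow> real) \<Rightarrow> (nat \<Rightarrow> real poly) \<Rightarrow> (nat \<Rightarrow> real) \<Rightarrow> nat \<Rightarrow> int \<Rightarrow> real"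
  where "orth_fun_hat N w P h m =
    (\<lambda>x. if x \<in> sites N then poly (P m) (of_int x) * of_int x * sqrt (w x) / h m else 0)"

definition eta :: "int \<Rightarrow> real"
  where "eta x = (if x = 0 then 1 / sqrt 2 else 1)"

definition ker0 :: "(nat \<Rightarrow> int \<Rightarrow> real) \<Rightarrow> nat \<Rightarrow> int \<Rightarrow> int \<Rightarrow> real"
  where "ker0 p n x y = 2 * eta x * eta y * (\<Sum>l<n. p (2 * l) x * p (2 * l) y)"

definition ker1 :: "(nat \<Rightarrow> int \<Rightarrow> real) \<Rightarrow> nat \<Rightarrow> int \<Rightarrow> int \<Rightarrow> real"
  where "ker1 q n x y = 2 * (\<Sum>l<n. q (2 * l) x * q (2 * l) y)"

text \<open>\<open>even_proj N p n\<close> projects onto the span of \<open>p\<^sub>0, p\<^sub>2, \<dots>\<close> up to index \<open>2n - 2\<close>; it is the operator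
  usually indexed by \<open>2n\<close>.\<close>

definition even_proj :: "nat \<Rightarrow> (nat \<Rightarrow> int \<Rightarrow> real) \<Rightarrow> nat \<Rightarrow> (int \<Rightarrow> real) \<Rightarrow> (int \<Rightarrow> real)"
  where "even_proj N p n = orth_proj N (span ((\<lambda>l. p (2 * l)) ` {..<n}))"


text \<open>Monic orthogonal polynomials exist below the cardinality of the support of the weight.\<close>

lemma monic_OPs_exist:
  assumes fin: "finite S" and nonneg: "\<And>x. x \<in> S \<Longrightarrow> u x \<ge> 0"
    and M: "M < card {x\<in>S. u x > 0}"
  shows "\<exists>P h. monic_OPs S u M P h"
proof -
  define ip where "ip p q = (\<Sum>x\<in>S. poly p (of_int x) * poly q (of_int x) * u x)" for p q :: "real poly"
  have ip_diff: "ip (a - b) c = ip a c - ip b c" for a b c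
    by (simp add: ip_def algebra_simps sum_subtractf)
  have ip_sum: "ip (\<Sum>i\<in>A. f i) c = (\<Sum>i\<in>A. ip (f i) c)" for A :: "nat set" and f c
    unfolding ip_def poly_sum sum_distrib_right by (rule sum.swap)
  have ip_smult: "ip (smult r b) c = r * ip b c" for r b c
    by (simp add: ip_def sum_distrib_left mult_ac)
  have ip_comm: "ip a b = ip b a" for a b
    by (simp add: ip_def mult_ac)
  have ip_pos: "ip q q > 0" if q: "q \<noteq> 0" "degree q \<le> M" for q
  proof -
    have "\<exists>x\<in>S. u x > 0 \<and> poly q (of_int x) \<noteq> 0"
    proof (rule ccontr)
      assume "\<not> ?thesis"
      then have sub: "real_of_int ` {x\<in>S. u x > 0} \<subseteq> {x. poly q x = 0}" by auto
      have "card {x\<in>S. u x > 0} = card (real_of_int ` {x\<in>S. u x > 0})"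
        by (intro card_image [symmetric] inj_onI) auto
      also have "\<dots> \<le> card {x. poly q x = 0}"
        by (rule card_mono [OF poly_roots_finite [OF q(1)] sub])
      also have "\<dots> \<le> degree q" by (rule card_poly_roots_bound [OF q(1)])
      finally show False using q(2) M by linarith
    qed
    then obtain x where x: "x \<in> S" "u x > 0" "poly q (of_int x) \<noteq> 0" by blast
    have "poly q (of_int x) * poly q (of_int x) > 0"
      using x(3) by (metis not_real_square_gt_zero)
    then have "poly q (of_int x) * poly q (of_int x) * u x > 0"
      using x(2) by (rule mult_pos_pos)
    then show ?thesis
      unfolding ip_def by (rule sum_pos2 [OF fin x(1)]) (simp add: nonneg)
  qed
  have "\<exists>P. \<forall>m<k. degree (P m) = m \<and> lead_coeff (P m) = 1 \<and> (\<forall>l<k. l \<noteq> m \<longrightarrow> ip (P m) (P l) = 0)"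
    if "k \<le> Suc M" for k
    using that
  proof (induction k)
    case 0
    then show ?case by simp
  next
    case (Suc k)
    then have "\<exists>P. \<forall>m<k. degree (P m) = m \<and> lead_coeff (P m) = 1 \<and> (\<forall>l<k. l \<noteq> m \<longrightarrow> ip (P m) (P l) = 0)"
      by simp
    then obtain P where P: "\<And>m. m < k \<Longrightarrow> degree (P m) = m" "\<And>m. m < k \<Longrightarrow> lead_coeff (P m) = 1"
        "\<And>m l. m < k \<Longrightarrow> l < k \<Longrightarrow> l \<noteq> m \<Longrightarrow> ip (P m) (P l) = 0"
      by metis
    define R where "R = (\<Sum>l<k. smult (ip (monom 1 k) (P l) / ip (P l) (P l)) (P l))"
    define Q where "Q = monom 1 k - R"
    have coeff_R: "coeff R i = 0" if "i \<ge> k" for i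
      using that P(1) unfolding R_def coeff_sum
      by (intro sum.neutral) (auto intro: coeff_eq_0)
    have coeff_Q: "coeff Q k = 1" "\<And>i. i > k \<Longrightarrow> coeff Q i = 0"
      by (auto simp: Q_def coeff_R)
    have deg_Q: "degree Q = k"
      by (intro antisym degree_le le_degree) (auto simp: coeff_Q)
    have orth: "ip Q (P l) = 0" if l: "l < k" for l
    proof -
      have "P l \<noteq> 0" using P(2) [OF l] by auto
      then have "ip (P l) (P l) \<noteq> 0" using ip_pos [of "P l"] P(1) [OF l] l Suc.prems by simp
      moreover have "ip R (P l) = (\<Sum>i<k. if i = l then ip (monom 1 k) (P i) / ip (P i) (P i) * ip (P i) (P l) else 0)"
        unfolding R_def ip_sum ip_smult by (intro sum.cong) (use P(3) l in auto)
      ultimately show ?thesis using l by (simp add: Q_def ip_diff)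
    qed
    show ?case
      by (rule exI [of _ "P(k := Q)"])
        (use P orth deg_Q coeff_Q ip_comm in \<open>auto simp: less_Suc_eq\<close>)
  qed
  from this [OF order.refl] obtain P where P: "\<And>m. m \<le> M \<Longrightarrow> degree (P m) = m"
      "\<And>m. m \<le> M \<Longrightarrow> lead_coeff (P m) = 1"
      "\<And>m l. m \<le> M \<Longrightarrow> l \<le> M \<Longrightarrow> l \<noteq> m \<Longrightarrow> ip (P m) (P l) = 0"
    unfolding less_Suc_eq_le by metis
  have pos: "ip (P m) (P m) > 0" if "m \<le> M" for m
    using ip_pos [of "P m"] P(1,2) [OF that] that by force
  have "monic_OPs S u M P (\<lambda>m. sqrt (ip (P m) (P m)))"
    unfolding monic_OPs_def ip_def [symmetric] using P pos by (auto simp: less_imp_le)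
  then show ?thesis by blast
qed

lemma monic_OPs_orth_lower:
  assumes P: "monic_OPs S u M P h" and k: "k \<le> M" and d: "d = 0 \<or> degree d < k"
  shows "(\<Sum>x\<in>S. poly d (of_int x) * poly (P k) (of_int x) * u x) = 0"
proof -
  define ip where "ip p q = (\<Sum>x\<in>S. poly p (of_int x) * poly q (of_int x) * u x)" for p q :: "real poly"
  have ip_add: "ip (a + b) c = ip a c + ip b c" for a b c
    by (simp add: ip_def algebra_simps sum.distrib)
  have ip_smult: "ip (smult r b) c = r * ip b c" for r b c
    by (simp add: ip_def sum_distrib_left mult_ac)
  have deg: "degree (P l) = l" and lc: "lead_coeff (P l) = 1" if "l \<le> M" for l
    using P that by (auto simp: monic_OPs_def)
  have PP: "ip (P l) (P k) = (if l = k then (h l)\<^sup>2 else 0)" if "l \<le> M" "k \<le> M" for l k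
    using P that by (auto simp: monic_OPs_def ip_def)
  have low: "ip d (P k) = 0" if "k \<le> M" "d = 0 \<or> degree d < k" for d k
    using that(2)
  proof (induction "degree d" arbitrary: d rule: less_induct)
    case less
    show ?case
    proof (cases "d = 0")
      case True
      then show ?thesis by (simp add: ip_def)
    next
      case False
      define j where "j = degree d"
      have j: "j < k" "j \<le> M" using less.prems False that(1) by (auto simp: j_def)
      define e where "e = d - smult (lead_coeff d) (P j)"
      have ce: "coeff e i = 0" if "i \<ge> j" for i
      proof (cases "i = j")
        case True
        then show ?thesis using lc [OF j(2)] deg [OF j(2)] by (simp add: e_def j_def)
      next
        case False
        then show ?thesis using that deg [OF j(2)] by (simp add: e_def coeff_eq_0 j_def)
      qed
      have e: "e = 0 \<or> degree e < j"
      proof (cases "e = 0")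
        case False
        then have "coeff e (degree e) \<noteq> 0" by simp
        then have "\<not> j \<le> degree e" using ce by blast
        then show ?thesis by simp
      qed simp
      then have "ip e (P k) = 0"
      proof
        assume "e = 0"
        then show ?thesis by (simp add: ip_def)
      next
        assume "degree e < j"
        then show ?thesis using less.hyps [of e] j by (auto simp: j_def)
      qed
      moreover have "d = e + smult (lead_coeff d) (P j)" by (simp add: e_def)
      ultimately have "ip d (P k) = lead_coeff d * ip (P j) (P k)"
        by (metis ip_add ip_smult add_0)
      then show ?thesis using PP [OF j(2) that(1)] j by simp
    qed
  qed
  from this [OF k d] show ?thesis by (simp add: ip_def)
qed

lemma monic_OPs_unique:
  assumes P: "monic_OPs S u M P h" and m: "m \<le> M"
    and Q: "degree Q = m" "lead_coeff Q = 1"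
    and orth: "\<And>l. l < m \<Longrightarrow> (\<Sum>x\<in>S. poly Q (of_int x) * poly (P l) (of_int x) * u x) = 0"
  shows "Q = P m"
proof (rule ccontr)
  define ip where "ip p q = (\<Sum>x\<in>S. poly p (of_int x) * poly q (of_int x) * u x)" for p q :: "real poly"
  have ip_add: "ip (a + b) c = ip a c + ip b c" and ip_diff: "ip (a - b) c = ip a c - ip b c" for a b c
    by (simp_all add: ip_def algebra_simps sum_subtractf sum.distrib)
  have ip_smult: "ip (smult r b) c = r * ip b c" for r b c
    by (simp add: ip_def sum_distrib_left mult_ac)
  have deg: "degree (P l) = l" and lc: "lead_coeff (P l) = 1" and hp: "h l > 0" if "l \<le> M" for l
    using P that by (auto simp: monic_OPs_def)
  have PP: "ip (P l) (P k) = (if l = k then (h l)\<^sup>2 else 0)" if "l \<le> M" "k \<le> M" for l k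
    using P that by (auto simp: monic_OPs_def ip_def)
  have low: "ip d (P k) = 0" if "k \<le> M" "d = 0 \<or> degree d < k" for d k
    unfolding ip_def by (rule monic_OPs_orth_lower [OF P that])
  assume ne: "Q \<noteq> P m"
  define d where "d = Q - P m"
  define k where "k = degree d"
  have d0: "d \<noteq> 0" using ne by (simp add: d_def)
  have cd: "coeff d i = 0" if "i \<ge> m" for i
  proof (cases "i = m")
    case True
    then show ?thesis using lc [OF m] deg [OF m] Q by (simp add: d_def)
  next
    case False
    then show ?thesis using that deg [OF m] Q by (simp add: d_def coeff_eq_0)
  qed
  have "coeff d (degree d) \<noteq> 0" using d0 by simp
  then have k: "k < m" using cd [of k] unfolding k_def by (meson not_le)
  define e where "e = d - smult (lead_coeff d) (P k)"
  have kM: "k \<le> M" using k m by simp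
  have ce: "coeff e i = 0" if "i \<ge> k" for i
  proof (cases "i = k")
    case True
    then show ?thesis using lc [OF kM] deg [OF kM] by (simp add: e_def k_def)
  next
    case False
    then show ?thesis using that deg [OF kM] by (simp add: e_def coeff_eq_0 k_def)
  qed
  have "e = 0 \<or> degree e < k"
  proof (cases "e = 0")
    case False
    then have "coeff e (degree e) \<noteq> 0" by simp
    then have "\<not> k \<le> degree e" using ce by blast
    then show ?thesis by simp
  qed simp
  then have "ip e (P k) = 0" by (rule low [OF kM])
  then have "ip d (P k) = lead_coeff d * (h k)\<^sup>2"
    using PP [OF kM kM] by (simp add: e_def ip_diff ip_smult)
  moreover have "ip d (P k) = 0"
    using orth [OF k] PP [OF m kM] k by (simp add: d_def ip_diff) (simp add: ip_def)
  ultimately show False using d0 hp [OF kM] by simp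
qed

lemma three_term_recurrence:
  assumes P: "monic_OPs (sites N) u M P h"
    and even: "\<And>x. x \<in> sites N \<Longrightarrow> u (- x) = u x"
    and m: "1 \<le> m" "m < M"
  shows "[:0, 1:] * P m = P (m + 1) + smult (rec_coeff h m) (P (m - 1))"
proof -
  define ip where "ip p q = (\<Sum>x\<in>sites N. poly p (of_int x) * poly q (of_int x) * u x)" for p q :: "real poly"
  have ip_add: "ip (a + b) c = ip a c + ip b c" and ip_diff: "ip (a - b) c = ip a c - ip b c" for a b c
    by (simp_all add: ip_def algebra_simps sum_subtractf sum.distrib)
  have ip_smult: "ip (smult r b) c = r * ip b c" for r b c
    by (simp add: ip_def sum_distrib_left mult_ac)
  have ip_comm: "ip a b = ip b a" for a b
    by (simp add: ip_def mult_ac)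
  have ip_X: "ip ([:0, 1:] * a) b = ip a ([:0, 1:] * b)" for a b
    by (simp add: ip_def mult_ac)
  have deg: "degree (P l) = l" and lc: "lead_coeff (P l) = 1" and hp: "h l > 0" if "l \<le> M" for l
    using P that by (auto simp: monic_OPs_def)
  have PP: "ip (P l) (P k) = (if l = k then (h l)\<^sup>2 else 0)" if "l \<le> M" "k \<le> M" for l k
    using P that by (auto simp: monic_OPs_def ip_def)
  have cm: "coeff (P l) l = 1" and c0: "i > l \<Longrightarrow> coeff (P l) i = 0" if "l \<le> M" for l i
    using lc [OF that] deg [OF that] by (simp_all add: coeff_eq_0)
  have monic: "ip Q (P k) = 0" if "k \<le> M" "degree Q < k" for Q k
    unfolding ip_def by (rule monic_OPs_orth_lower [OF P]) (use that in auto)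
  have parity: "poly (P m) (- x) = (- 1) ^ m * poly (P m) x" for x
  proof -
    define Q where "Q = smult ((- 1) ^ m) (P m \<circ>\<^sub>p [:0, - 1:])"
    have dQ: "degree (P m \<circ>\<^sub>p [:0, - 1:]) = m" using deg [of m] m by (simp add: degree_pcompose)
    have "lead_coeff (P m \<circ>\<^sub>p [:0, - 1:]) = (- 1) ^ m"
      using lc [of m] m deg [of m] by (subst lead_coeff_comp) simp_all
    then have lQ: "lead_coeff Q = 1"
      using dQ by (simp add: Q_def flip: power_mult_distrib)
    have "Q = P m"
    proof (rule monic_OPs_unique [OF P])
      show "m \<le> M" using m by simp
      show "degree Q = m" using dQ by (simp add: Q_def)
      show "lead_coeff Q = 1" by (rule lQ)
      fix l assume l: "l < m"
      have "(\<Sum>x\<in>sites N. poly Q (of_int x) * poly (P l) (of_int x) * u x)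
          = (\<Sum>x\<in>sites N. poly Q (of_int (- x)) * poly (P l) (of_int (- x)) * u (- x))"
        by (rule sum.reindex_bij_witness [of _ uminus uminus]) (auto simp: sites_def)
      also have "\<dots> = (- 1) ^ m * ip (P l \<circ>\<^sub>p [:0, - 1:]) (P m)"
        using even by (simp add: ip_def Q_def poly_pcompose sum_distrib_left mult_ac)
      also have "ip (P l \<circ>\<^sub>p [:0, - 1:]) (P m) = 0"
        using l m deg [of l] by (intro monic) (simp_all add: degree_pcompose)
      finally show "(\<Sum>x\<in>sites N. poly Q (of_int x) * poly (P l) (of_int x) * u x) = 0" by simp
    qed
    then have "poly (P m) x = (- 1) ^ m * poly (P m) (- x)"
      by (metis Q_def mult_minus1_right poly_pCons poly_0 poly_pcompose poly_smult
          add_0 mult_zero_right add.right_neutral)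
    then show ?thesis by (simp flip: mult.assoc power_mult_distrib)
  qed
  have odd: "ip ([:0, 1:] * P m) (P m) = 0"
  proof -
    have "ip ([:0, 1:] * P m) (P m) = (\<Sum>x\<in>sites N. poly ([:0, 1:] * P m) (of_int (- x)) * poly (P m) (of_int (- x)) * u (- x))"
      unfolding ip_def by (rule sum.reindex_bij_witness [of _ uminus uminus]) (auto simp: sites_def)
    also have "\<dots> = (\<Sum>x\<in>sites N. - (poly ([:0, 1:] * P m) (of_int x) * poly (P m) (of_int x) * u x))"
    proof (rule sum.cong)
      fix x assume x: "x \<in> sites N"
      have "((- 1) ^ m * a) * ((- 1) ^ m * b) = a * (b::real)" for a b
        by (simp add: mult_ac flip: mult.assoc power_mult_distrib)
      from this [of "poly (P m) (of_int x)" "poly (P m) (of_int x)"]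
      show "poly ([:0, 1:] * P m) (of_int (- x)) * poly (P m) (of_int (- x)) * u (- x)
          = - (poly ([:0, 1:] * P m) (of_int x) * poly (P m) (of_int x) * u x)"
        using even [OF x] parity [of "of_int x"] by (simp add: mult_ac)
    qed simp
    also have "\<dots> = - ip ([:0, 1:] * P m) (P m)" by (simp only: ip_def sum_negf)
    finally show ?thesis by simp
  qed
  define r where "r = rec_coeff h m"
  define Q where "Q = [:0, 1:] * P m - smult r (P (m - 1))"
  have cXP: "coeff ([:0, 1:] * P l) i = (case i of 0 \<Rightarrow> 0 | Suc j \<Rightarrow> coeff (P l) j)" for l i
    by (simp add: coeff_pCons)
  have cQ: "coeff Q (m + 1) = 1" "\<And>i. i > m + 1 \<Longrightarrow> coeff Q i = 0"
    using cm [of m] c0 [of m] c0 [of "m - 1"] m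
    by (auto simp: Q_def cXP split: nat.splits simp del: mult_pCons_left)
  have dQ: "degree Q = m + 1"
    by (intro antisym degree_le le_degree) (use cQ in auto)
  have "Q = P (m + 1)"
  proof (rule monic_OPs_unique [OF P])
    show "m + 1 \<le> M" "degree Q = m + 1" "lead_coeff Q = 1" using m dQ cQ by auto
    fix l assume l: "l < m + 1"
    have Pm: "ip (P (m - 1)) (P l) = (if l = m - 1 then (h (m - 1))\<^sup>2 else 0)"
      using PP [of "m - 1" l] l m by auto
    consider "l = m" | "l = m - 1" | "l + 1 < m" using l by linarith
    then have "ip Q (P l) = 0"
    proof cases
      case 1
      then show ?thesis using odd Pm m by (simp only: Q_def ip_diff ip_smult) simp
    next
      case 2
      define e where "e = [:0, 1:] * P l - P m"
      have "coeff e i = 0" if "i \<ge> m" for i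
        using that 2 m cm [of m] cm [of l] c0 [of m i] c0 [of l "i - 1"]
        by (cases "i = m") (auto simp: e_def cXP split: nat.splits simp del: mult_pCons_left)
      then have "degree e < m \<or> e = 0"
        by (metis leading_coeff_0_iff not_le)
      then have "ip e (P m) = 0" using monic [of m e] m by (auto simp: ip_def)
      then have "ip ([:0, 1:] * P l) (P m) = (h m)\<^sup>2"
        using PP [of m m] m by (simp only: e_def ip_diff) simp
      then have "ip ([:0, 1:] * P m) (P l) = (h m)\<^sup>2"
        using ip_X [of "P m" "P l"] ip_comm by metis
      then have "ip Q (P l) = (h m)\<^sup>2 - r * (h (m - 1))\<^sup>2"
        using Pm 2 by (simp only: Q_def ip_diff ip_smult) simp
      then show ?thesis using less_imp_neq [OF hp [of "m - 1"]] m by (simp add: r_def rec_coeff_def)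
    next
      case 3
      have "degree ([:0, 1:] * P l) \<le> degree [:0, 1::real:] + degree (P l)" by (rule degree_mult_le)
      then have "degree ([:0, 1:] * P l) < m" using 3 deg [of l] m by simp
      then have "ip ([:0, 1:] * P l) (P m) = 0" using monic m by simp
      then have "ip ([:0, 1:] * P m) (P l) = 0"
        using ip_X [of "P m" "P l"] ip_comm by metis
      then show ?thesis using Pm 3 by (simp only: Q_def ip_diff ip_smult) simp
    qed
    then show "(\<Sum>x\<in>sites N. poly Q (of_int x) * poly (P l) (of_int x) * u x) = 0"
      by (simp add: ip_def)
  qed
  then show ?thesis by (simp add: Q_def r_def algebra_simps)
qed

end

theory Submission
  imports Defs
begin

text \<open>The odd polynomials \<open>P\<^sub>2\<^sub>l\<^sub>+\<^sub>1\<close> are divisible by \<open>x\<close>, and the quotients are orthogonal for the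
  weight \<open>x\<^sup>2 w(x)\<close>. By uniqueness \<open>x\<close> times the hatted polynomial of degree \<open>2l\<close> is \<open>P\<^sub>2\<^sub>l\<^sub>+\<^sub>1\<close>, so the
  hatted orthonormal function of index \<open>2l\<close> is simply \<open>p\<^sub>2\<^sub>l\<^sub>+\<^sub>1\<close>
  (\<open>orth_fun_hat_even\<close>). After this substitution the two kernels are the even and the odd part of
  one Christoffel--Darboux sum. Expanding \<open>x p\<^sub>2\<^sub>l\<^sub>+\<^sub>1(x)\<close> and \<open>y p\<^sub>2\<^sub>l(y)\<close> by the three-term recurrence
  makes their difference telescope, and only the top boundary term \<open>p\<^sub>2\<^sub>n(x) p\<^sub>2\<^sub>n\<^sub>+\<^sub>1(y)\<close> survives
  (\<open>even_odd_Christoffel_Darboux\<close>).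

  The operator statement follows because the projection onto the span of a finite orthonormal
  system is given by the sum of its coefficients (\<open>orth_proj_orthonormal\<close>). The image is contained
  in the line through \<open>p\<^sub>2\<^sub>n\<close>; it is the whole line, since
  \<open>- x p\<^sub>2\<^sub>n\<^sub>+\<^sub>1(x) / sqrt \<beta>\<^sub>2\<^sub>n\<^sub>+\<^sub>1\<close> is mapped to \<open>p\<^sub>2\<^sub>n\<close>: its coefficient is the squared
  norm of \<open>p\<^sub>2\<^sub>n\<^sub>+\<^sub>1\<close> without the site \<open>0\<close>, and this is \<open>1\<close> because \<open>p\<^sub>2\<^sub>n\<^sub>+\<^sub>1(0) = 0\<close>.\<close>

section \<open>Projections and the inverse of multiplication\<close>

lemma finite_sites [simp]: "finite (sites N)"
  by (simp add: sites_def)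

lemma sum_fun_apply: "(\<Sum>i\<in>I. g i) x = (\<Sum>i\<in>I. g i x)"
  for g :: "'i \<Rightarrow> 'a \<Rightarrow> 'b::comm_monoid_add"
  by (induction I rule: infinite_finite_induct) auto

lemma subspace_ell2: "subspace (ell2 N)"
  by (auto simp: subspace_def ell2_def scaleR_fun_def)

lemma ell2_inner_self_eq_0:
  assumes "f \<in> ell2 N" "ell2_inner N f f = 0"
  shows "f = 0"
proof
  fix x
  have "\<forall>x\<in>sites N. f x * f x = 0"
    using assms(2) by (subst (asm) ell2_inner_def, subst (asm) sum_nonneg_eq_0_iff) auto
  then show "f x = 0 x"
    using assms(1) by (cases "x \<in> sites N") (auto simp: ell2_def)
qed

lemma subspace_ell2_orthogonal: "subspace {v. ell2_inner N g v = 0}"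
  by (auto simp: subspace_def ell2_inner_def scaleR_fun_def distrib_left sum.distrib
      mult.left_commute simp flip: sum_distrib_left)

lemma orth_proj_orthonormal:
  assumes fin: "finite I" and e: "\<And>i. i \<in> I \<Longrightarrow> e i \<in> ell2 N"
    and on: "\<And>i j. i \<in> I \<Longrightarrow> j \<in> I \<Longrightarrow> ell2_inner N (e i) (e j) = (if i = j then 1 else 0)"
  shows "orth_proj N (span (e ` I)) f = (\<lambda>x. \<Sum>i\<in>I. ell2_inner N f (e i) * e i x)"
proof -
  define g where "g = (\<Sum>i\<in>I. ell2_inner N f (e i) *\<^sub>R e i)"
  have g_apply: "g x = (\<Sum>i\<in>I. ell2_inner N f (e i) * e i x)" for x
    by (simp add: g_def sum_fun_apply scaleR_fun_def)
  have g_span: "g \<in> span (e ` I)"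
    unfolding g_def by (intro span_sum span_scale span_base) auto
  have "ell2_inner N (f - g) (e j) = 0" if j: "j \<in> I" for j
  proof -
    have "ell2_inner N g (e j) = (\<Sum>i\<in>I. ell2_inner N f (e i) * ell2_inner N (e i) (e j))"
      unfolding ell2_inner_def g_apply sum_distrib_left sum_distrib_right
      by (subst sum.swap) (simp add: mult_ac)
    also have "\<dots> = (\<Sum>i\<in>I. if i = j then ell2_inner N f (e i) else 0)"
      by (intro sum.cong) (auto simp: on j)
    also have "\<dots> = ell2_inner N f (e j)"
      using fin j by simp
    finally show ?thesis
      by (simp add: ell2_inner_def left_diff_distrib sum_subtractf)
  qed
  then have g_orth: "ell2_inner N (f - g) v = 0" if "v \<in> span (e ` I)" for v
    using that span_minimal [OF _ subspace_ell2_orthogonal, of "e ` I" N "f - g"] by auto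
  have "orth_proj N (span (e ` I)) f = g"
    unfolding orth_proj_def
  proof (rule the_equality)
    show "g \<in> span (e ` I) \<and> (\<forall>v\<in>span (e ` I). ell2_inner N (f - g) v = 0)"
      using g_span g_orth by blast
    fix g' assume g': "g' \<in> span (e ` I) \<and> (\<forall>v\<in>span (e ` I). ell2_inner N (f - g') v = 0)"
    have d: "g' - g \<in> span (e ` I)"
      using g' g_span by (blast intro: span_diff)
    have "ell2_inner N (g' - g) (g' - g)
        = ell2_inner N (f - g) (g' - g) - ell2_inner N (f - g') (g' - g)"
      by (simp add: ell2_inner_def flip: sum_subtractf) (simp add: algebra_simps)
    then have "ell2_inner N (g' - g) (g' - g) = 0"
      using g' g_orth d by simp
    moreover have "g' - g \<in> ell2 N"
      using span_minimal [OF _ subspace_ell2, of "e ` I" N] e d by auto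
    ultimately show "g' = g"
      using ell2_inner_self_eq_0 by fastforce
  qed
  then show ?thesis
    using g_apply by auto
qed

lemma inv_X_apply:
  assumes f: "f \<in> ell2_0 N"
  shows "inv_X N f = (\<lambda>x. f x / of_int x)"
  unfolding inv_X_def
proof (rule inv_into_f_eq)
  show "inj_on mult_X (ell2_0 N)"
  proof (rule inj_onI, rule ext)
    fix g g' x assume "g \<in> ell2_0 N" "g' \<in> ell2_0 N" and eq: "mult_X g = mult_X g'"
    have "of_int x * g x = of_int x * g' x"
      using fun_cong [OF eq, of x] by (simp add: mult_X_def)
    then show "g x = g' x"
      using \<open>g \<in> ell2_0 N\<close> \<open>g' \<in> ell2_0 N\<close> by (cases "x = 0") (auto simp: ell2_0_def)
  qed
  show "(\<lambda>x. f x / of_int x) \<in> ell2_0 N" "mult_X (\<lambda>x. f x / of_int x) = f"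
    using f by (auto simp: ell2_0_def ell2_def mult_X_def)
qed

section \<open>Orthogonal polynomials for an even weight\<close>

lemma orth_fun_in_ell2: "orth_fun N w P h m \<in> ell2 N"
  by (simp add: orth_fun_def ell2_def)

lemma orth_fun_orthonormal:
  assumes P: "monic_OPs (sites N) w M P h" and w: "\<And>x. x \<in> sites N \<Longrightarrow> w x \<ge> 0"
    and ml: "m \<le> M" "l \<le> M"
  shows "ell2_inner N (orth_fun N w P h m) (orth_fun N w P h l) = (if m = l then 1 else 0)"
proof -
  have "ell2_inner N (orth_fun N w P h m) (orth_fun N w P h l)
      = (\<Sum>x\<in>sites N. poly (P m) (of_int x) * poly (P l) (of_int x) * w x / (h m * h l))"
    unfolding ell2_inner_def
  proof (rule sum.cong)
    fix x assume x: "x \<in> sites N"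
    have "sqrt (w x) * sqrt (w x) = w x" using w [OF x] by simp
    then have "a * sqrt (w x) * (b * sqrt (w x)) = a * b * w x" for a b
      by (metis mult.assoc mult.commute)
    then show "orth_fun N w P h m x * orth_fun N w P h l x
        = poly (P m) (of_int x) * poly (P l) (of_int x) * w x / (h m * h l)"
      using x by (simp add: orth_fun_def)
  qed simp
  also have "\<dots> = (if m = l then (h m)\<^sup>2 else 0) / (h m * h l)"
    using P ml by (simp add: monic_OPs_def flip: sum_divide_distrib)
  also have "\<dots> = (if m = l then 1 else 0)"
    using P ml by (auto simp: monic_OPs_def power2_eq_square)
  finally show ?thesis .
qed

text \<open>The recurrence with coefficient \<open>\<beta>\<^sub>m\<close> starts at \<open>m = 1\<close>; this is its initial step \<open>m = 0\<close>.\<close>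

lemma monic_OPs_0_1:
  assumes P: "monic_OPs (sites N) w M P h"
    and even: "\<And>x. x \<in> sites N \<Longrightarrow> w (- x) = w x" and M: "1 \<le> M"
  shows "P 0 = 1" "P 1 = [:0, 1:]"
proof -
  have "degree (P 0) = 0" "lead_coeff (P 0) = 1"
    using P by (auto simp: monic_OPs_def)
  then show P0: "P 0 = 1"
    by (metis degree_eq_zeroE lead_coeff_pCons(2) one_pCons)
  have "(\<Sum>x\<in>sites N. of_int x * w x) = (\<Sum>x\<in>sites N. of_int (- x) * w (- x))"
    by (rule sum.reindex_bij_witness [of _ uminus uminus]) (auto simp: sites_def)
  also have "\<dots> = - (\<Sum>x\<in>sites N. of_int x * w x)"
    by (simp add: even sum_negf)
  finally have "(\<Sum>x\<in>sites N. of_int x * w x) = 0" by simp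
  then have "[:0, 1:] = P 1"
    by (intro monic_OPs_unique [OF P M]) (auto simp: P0)
  then show "P 1 = [:0, 1:]" by simp
qed

lemma odd_OP_at_0:
  assumes P: "monic_OPs (sites N) w M P h"
    and even: "\<And>x. x \<in> sites N \<Longrightarrow> w (- x) = w x" and l: "2 * l + 1 \<le> M"
  shows "poly (P (2 * l + 1)) 0 = 0"
  using l
proof (induction l)
  case 0
  then show ?case using monic_OPs_0_1 [OF P even] by simp
next
  case (Suc l)
  have "[:0, 1:] * P (2 * l + 2) = P (2 * l + 3) + smult (rec_coeff h (2 * l + 2)) (P (2 * l + 1))"
    using three_term_recurrence [OF P even, of "2 * l + 2"] Suc.prems by (simp add: numeral_eq_Suc)
  from arg_cong [OF this, of "\<lambda>q. poly q 0"] show ?case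
    using Suc by (simp add: numeral_eq_Suc)
qed

section \<open>Hatted polynomials of even degree\<close>

text \<open>Dividing the odd polynomial by \<open>x\<close> gives a monic polynomial \<open>R\<close> of degree \<open>2l\<close>. One factor
  \<open>x\<close> of the weight \<open>x\<^sup>2 w(x)\<close> turns \<open>R\<close> back into the odd polynomial and the other raises the
  degree of the test polynomial by one, so \<open>R\<close> inherits the orthogonality.\<close>

lemma hat_OP_even:
  assumes P: "monic_OPs (sites N) w M P h"
    and Phat: "monic_OPs (sites N) (\<lambda>x. (of_int x)\<^sup>2 * w x) M' Phat hhat"
    and even: "\<And>x. x \<in> sites N \<Longrightarrow> w (- x) = w x"
    and l: "2 * l + 1 \<le> M" "2 * l \<le> M'"
  shows "P (2 * l + 1) = [:0, 1:] * Phat (2 * l)" "hhat (2 * l) = h (2 * l + 1)"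
proof -
  let ?m = "2 * l + 1"
  have deg: "degree (P ?m) = ?m" "lead_coeff (P ?m) = 1"
    using P l by (auto simp: monic_OPs_def)
  have "[:- 0, 1:] dvd P ?m"
    using odd_OP_at_0 [OF P even l(1)] by (simp only: poly_eq_0_iff_dvd)
  then obtain R where R: "P ?m = [:0, 1:] * R" by (auto elim: dvdE)
  have "R \<noteq> 0" using R deg by auto
  then have R_deg: "degree R = 2 * l" "lead_coeff R = 1"
    using deg [unfolded R] by (simp_all add: degree_mult_eq)
  have "R = Phat (2 * l)"
  proof (rule monic_OPs_unique [OF Phat l(2) R_deg])
    fix k assume k: "k < 2 * l"
    have "degree (Phat k) = k" using Phat k l by (auto simp: monic_OPs_def)
    then have "degree ([:0, 1:] * Phat k) < ?m"
      using degree_mult_le [of "[:0, 1:]" "Phat k"] k by simp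
    then have "(\<Sum>x\<in>sites N. poly ([:0, 1:] * Phat k) (of_int x) * poly (P ?m) (of_int x) * w x) = 0"
      by (intro monic_OPs_orth_lower [OF P l(1)]) simp
    then show "(\<Sum>x\<in>sites N. poly R (of_int x) * poly (Phat k) (of_int x) * ((of_int x)\<^sup>2 * w x)) = 0"
      unfolding R by (simp add: power2_eq_square mult_ac)
  qed
  then show PR: "P ?m = [:0, 1:] * Phat (2 * l)" using R by simp
  have "(hhat (2 * l))\<^sup>2
      = (\<Sum>x\<in>sites N. poly (Phat (2 * l)) (of_int x) * poly (Phat (2 * l)) (of_int x) * ((of_int x)\<^sup>2 * w x))"
    using Phat l by (simp add: monic_OPs_def)
  also have "\<dots> = (\<Sum>x\<in>sites N. poly (P ?m) (of_int x) * poly (P ?m) (of_int x) * w x)"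
    unfolding PR by (simp add: power2_eq_square mult_ac)
  also have "\<dots> = (h ?m)\<^sup>2"
    using P l by (simp add: monic_OPs_def)
  finally show "hhat (2 * l) = h ?m"
    using P Phat l by (auto simp: monic_OPs_def power2_eq_iff_nonneg less_imp_le)
qed

lemma orth_fun_hat_even:
  assumes "monic_OPs (sites N) w M P h"
    and "monic_OPs (sites N) (\<lambda>x. (of_int x)\<^sup>2 * w x) M' Phat hhat"
    and "\<And>x. x \<in> sites N \<Longrightarrow> w (- x) = w x"
    and "2 * l + 1 \<le> M" "2 * l \<le> M'"
  shows "orth_fun_hat N w Phat hhat (2 * l) = orth_fun N w P h (2 * l + 1)"
  using hat_OP_even [OF assms] by (simp add: orth_fun_hat_def orth_fun_def fun_eq_iff mult_ac)

section \<open>Christoffel--Darboux sums split by parity\<close>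

lemma sqrt_rec_coeff:
  assumes "h m > 0" "h (m - 1) > 0"
  shows "sqrt (rec_coeff h m) = h m / h (m - 1)"
  using assms by (simp add: rec_coeff_def real_sqrt_divide)

lemma orth_fun_recurrence:
  assumes P: "monic_OPs (sites N) w M P h"
    and even: "\<And>x. x \<in> sites N \<Longrightarrow> w (- x) = w x"
    and m: "1 \<le> m" "m < M" and x: "x \<in> sites N"
  shows "of_int x * orth_fun N w P h m x
      = sqrt (rec_coeff h (m + 1)) * orth_fun N w P h (m + 1) x
        + sqrt (rec_coeff h m) * orth_fun N w P h (m - 1) x"
proof -
  have h: "h (m - 1) > 0" "h m > 0" "h (m + 1) > 0"
    using P m by (auto simp: monic_OPs_def)
  have sq: "sqrt (rec_coeff h (m + 1)) = h (m + 1) / h m" "sqrt (rec_coeff h m) = h m / h (m - 1)"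
    using sqrt_rec_coeff [of h "m + 1"] sqrt_rec_coeff [of h m] h by simp_all
  have rec: "of_int x * poly (P m) (of_int x)
      = poly (P (m + 1)) (of_int x) + (h m)\<^sup>2 / (h (m - 1))\<^sup>2 * poly (P (m - 1)) (of_int x)"
    using arg_cong [OF three_term_recurrence [OF P even m], of "\<lambda>q. poly q (of_int x)"]
    by (simp add: rec_coeff_def)
  have "of_int x * orth_fun N w P h m x = (of_int x * poly (P m) (of_int x)) * sqrt (w x) / h m"
    using x by (simp add: orth_fun_def)
  also have "\<dots> = h (m + 1) / h m * orth_fun N w P h (m + 1) x
        + h m / h (m - 1) * orth_fun N w P h (m - 1) x"
    unfolding rec using x h by (simp add: orth_fun_def divide_simps) (simp add: algebra_simps power2_eq_square)
  finally show ?thesis by (simp only: sq)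
qed

text \<open>The induction on \<open>n\<close> is the telescoping sum: raising \<open>n\<close> adds \<open>x p\<^sub>2\<^sub>n\<^sub>+\<^sub>1(x) p\<^sub>2\<^sub>n\<^sub>+\<^sub>1(y)\<close>, whose two
  recurrence terms cancel the old boundary term and one term of \<open>y p\<^sub>2\<^sub>n\<^sub>+\<^sub>2(y) p\<^sub>2\<^sub>n\<^sub>+\<^sub>2(x)\<close>.\<close>

lemma even_odd_Christoffel_Darboux:
  fixes N :: nat and w :: "int \<Rightarrow> real" and h :: "nat \<Rightarrow> real" and P :: "nat \<Rightarrow> real poly"
  defines "q \<equiv> orth_fun N w P h"
  assumes P: "monic_OPs (sites N) w M P h"
    and even: "\<And>x. x \<in> sites N \<Longrightarrow> w (- x) = w x"
    and n: "2 * n + 1 \<le> M" and xy: "x \<in> sites N" "y \<in> sites N"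
  shows "of_int x * (\<Sum>l<n. q (2 * l + 1) x * q (2 * l + 1) y)
      - of_int y * (\<Sum>l<n + 1. q (2 * l) x * q (2 * l) y)
      = - sqrt (rec_coeff h (2 * n + 1)) * q (2 * n) x * q (2 * n + 1) y"
  using n
proof (induction n)
  case 0
  have h: "h 0 > 0" "h 1 > 0" using P 0 by (auto simp: monic_OPs_def)
  have "of_int y * q 0 y = sqrt (rec_coeff h 1) * q 1 y"
    using monic_OPs_0_1 [OF P even] sqrt_rec_coeff [of h 1] h 0 xy(2) by (simp add: q_def orth_fun_def)
  then show ?case by simp
next
  case (Suc n)
  let ?b = "\<lambda>m. sqrt (rec_coeff h m)"
  note rec = orth_fun_recurrence [OF P even, folded q_def]
  have rx: "of_int x * q (2 * n + 1) x = ?b (2 * n + 2) * q (2 * n + 2) x + ?b (2 * n + 1) * q (2 * n) x"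
    using rec [of "2 * n + 1" x] Suc.prems xy by simp
  have ry: "of_int y * q (2 * n + 2) y = ?b (2 * n + 3) * q (2 * n + 3) y + ?b (2 * n + 2) * q (2 * n + 1) y"
    using rec [of "2 * n + 2" y] Suc.prems xy by (simp add: numeral_eq_Suc)
  define A where "A = (\<Sum>l<n. q (2 * l + 1) x * q (2 * l + 1) y)"
  define B where "B = (\<Sum>l<n + 1. q (2 * l) x * q (2 * l) y)"
  have IH: "of_int x * A - of_int y * B = - ?b (2 * n + 1) * q (2 * n) x * q (2 * n + 1) y"
    using Suc by (simp add: A_def B_def)
  have "of_int x * (A + q (2 * n + 1) x * q (2 * n + 1) y) - of_int y * (B + q (2 * n + 2) x * q (2 * n + 2) y)
      = (of_int x * A - of_int y * B) + (of_int x * q (2 * n + 1) x) * q (2 * n + 1) y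
        - (of_int y * q (2 * n + 2) y) * q (2 * n + 2) x"
    by (simp add: algebra_simps)
  also have "\<dots> = - ?b (2 * n + 3) * q (2 * n + 2) x * q (2 * n + 3) y"
    unfolding IH rx ry by (simp add: algebra_simps)
  finally show ?case
    by (simp add: A_def B_def numeral_eq_Suc)
qed

section \<open>The rank-one difference of the projections\<close>

theorem proposition3p2:
  fixes N n :: nat and w :: "int \<Rightarrow> real"
    and P Phat :: "nat \<Rightarrow> real poly" and h hhat :: "nat \<Rightarrow> real"
    and p phat :: "nat \<Rightarrow> int \<Rightarrow> real"
  assumes even_w: "\<And>x. x \<in> sites N \<Longrightarrow> w (- x) = w x"
    and pos_w: "\<And>x. x \<in> sites N \<Longrightarrow> x \<noteq> 0 \<Longrightarrow> w x > 0"
    and nonneg_w0: "w 0 \<ge> 0"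
    and n: "1 \<le> n" "n \<le> N - 1"
    and P: "monic_OPs (sites N) w (if w 0 > 0 then 2 * N else 2 * N - 1) P h"
    and Phat: "monic_OPs (sites N) (\<lambda>x. (of_int x)\<^sup>2 * w x) (2 * N - 1) Phat hhat"
    and p: "p = orth_fun N w P h"
    and phat: "phat = orth_fun_hat N w Phat hhat"
  shows
    "(\<forall>x\<in>sites N. \<forall>y\<in>sites N - {0}.
        of_int x / (2 * of_int y) * ker1 phat n x y - 1 / (2 * eta x) * ker0 p (n + 1) x y
        = - (sqrt (rec_coeff h (2 * n + 1)) / of_int y) * p (2 * n) x * p (2 * n + 1) y)
   \<and> (\<forall>f\<in>ell2_0 N. \<forall>x\<in>sites N.
        (mult_X (even_proj N phat n (inv_X N f)) - even_proj N p (n + 1) f) x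
        = (\<Sum>y\<in>sites N - {0}.
             (of_int x / (2 * of_int y) * ker1 phat n x y - 1 / (2 * eta x) * ker0 p (n + 1) x y) * f y))
   \<and> dim ((\<lambda>f. mult_X (even_proj N phat n (inv_X N f)) - even_proj N p (n + 1) f) ` ell2_0 N) = 1
   \<and> (w 0 = 0 \<longrightarrow>
        (\<forall>x\<in>sites N. \<forall>y\<in>sites N - {0}.
           of_int x / (2 * of_int y) * ker1 phat n x y - 1 / 2 * ker0 p (n + 1) x y
           = - (sqrt (rec_coeff h (2 * n + 1)) / of_int y) * p (2 * n) x * p (2 * n + 1) y))"
proof -
  define M where "M = (if w 0 > 0 then 2 * N else 2 * N - 1)"
  define b where "b = sqrt (rec_coeff h (2 * n + 1))"
  define T where "T f = mult_X (even_proj N phat n (inv_X N f)) - even_proj N p (n + 1) f" for f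
  define K where "K x y = of_int x / (2 * of_int y) * ker1 phat n x y - 1 / (2 * eta x) * ker0 p (n + 1) x y"
    for x y
  note P' = P [folded M_def]
  have nM: "2 * n + 1 \<le> M" using n by (auto simp: M_def)
  have w: "w x \<ge> 0" if "x \<in> sites N" for x
    using pos_w [OF that] nonneg_w0 by (cases "x = 0") auto
  have phat_even: "phat (2 * l) = p (2 * l + 1)" if "l < n" for l
    unfolding p phat by (rule orth_fun_hat_even [OF P' Phat even_w]) (use that n nM in auto)
  have p_ell2: "p m \<in> ell2 N" for m
    unfolding p by (rule orth_fun_in_ell2)
  have on: "ell2_inner N (p i) (p j) = (if i = j then 1 else 0)" if "i \<le> 2 * n + 1" "j \<le> 2 * n + 1" for i j
    unfolding p by (rule orth_fun_orthonormal [OF P' w]) (use that nM in auto)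
  have eta: "eta x \<noteq> 0" for x by (simp add: eta_def)

  have K_eq: "K x y = of_int x / of_int y * (\<Sum>l<n. phat (2 * l) x * phat (2 * l) y)
      - (\<Sum>l<n + 1. p (2 * l) x * p (2 * l) y)" if "y \<noteq> 0" for x y
    using that eta [of x] by (simp add: K_def ker0_def ker1_def eta_def [of y])
  have K_rank1: "K x y = - (b / of_int y) * p (2 * n) x * p (2 * n + 1) y"
    if xy: "x \<in> sites N" "y \<in> sites N" "y \<noteq> 0" for x y
  proof -
    let ?A = "\<Sum>l<n. p (2 * l + 1) x * p (2 * l + 1) y"
    let ?B = "\<Sum>l<n + 1. p (2 * l) x * p (2 * l) y"
    have "K x y = of_int x / of_int y * ?A - ?B"
      unfolding K_eq [OF xy(3)] by (simp add: phat_even)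
    also have "\<dots> = (of_int x * ?A - of_int y * ?B) / of_int y"
      using xy(3) by (simp add: diff_divide_distrib)
    also have "\<dots> = (- b * p (2 * n) x * p (2 * n + 1) y) / of_int y"
      using even_odd_Christoffel_Darboux [OF P' even_w nM xy(1,2)] by (simp only: p b_def)
    finally show ?thesis by simp
  qed

  have proj_p: "even_proj N p (n + 1) f = (\<lambda>x. \<Sum>l<n + 1. ell2_inner N f (p (2 * l)) * p (2 * l) x)" for f
    unfolding even_proj_def by (rule orth_proj_orthonormal) (auto simp: p_ell2 on)
  have proj_phat: "even_proj N phat n f = (\<lambda>x. \<Sum>l<n. ell2_inner N f (phat (2 * l)) * phat (2 * l) x)" for f
    unfolding even_proj_def by (rule orth_proj_orthonormal) (auto simp: phat_even p_ell2 on)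

  have T_K: "T f x = (\<Sum>y\<in>sites N - {0}. K x y * f y)" if f: "f \<in> ell2_0 N" for f x
  proof -
    have f0: "f 0 = 0" using f by (simp add: ell2_0_def)
    have drop0: "(\<Sum>y\<in>sites N. g y) = (\<Sum>y\<in>sites N - {0}. g y)" if "g 0 = 0" for g :: "int \<Rightarrow> real"
      using that by (intro sum.mono_neutral_right) auto
    have 1: "mult_X (even_proj N phat n (inv_X N f)) x
        = (\<Sum>y\<in>sites N - {0}. of_int x / of_int y * (\<Sum>l<n. phat (2 * l) x * phat (2 * l) y) * f y)"
      unfolding mult_X_def proj_phat inv_X_apply [OF f] ell2_inner_def sum_distrib_left sum_distrib_right
      by (subst sum.swap, subst drop0) (simp_all add: f0 mult_ac)
    have 2: "even_proj N p (n + 1) f x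
        = (\<Sum>y\<in>sites N - {0}. (\<Sum>l<n + 1. p (2 * l) x * p (2 * l) y) * f y)"
      unfolding proj_p ell2_inner_def sum_distrib_left sum_distrib_right
      by (subst sum.swap, subst drop0) (simp_all only: f0 mult_ac mult_zero_left sum.neutral_const)
    show ?thesis
      unfolding T_def minus_apply 1 2 sum_subtractf [symmetric]
      by (intro sum.cong) (auto simp: K_eq left_diff_distrib)
  qed
  have T_rank1: "T f = (- b * (\<Sum>y\<in>sites N - {0}. p (2 * n + 1) y / of_int y * f y)) *\<^sub>R p (2 * n)"
    if f: "f \<in> ell2_0 N" for f
  proof
    fix x
    show "T f x = ((- b * (\<Sum>y\<in>sites N - {0}. p (2 * n + 1) y / of_int y * f y)) *\<^sub>R p (2 * n)) x"
    proof (cases "x \<in> sites N")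
      case True
      then have "T f x = (\<Sum>y\<in>sites N - {0}. (- b * (p (2 * n + 1) y / of_int y * f y)) * p (2 * n) x)"
        unfolding T_K [OF f] by (intro sum.cong) (auto simp: K_rank1)
      then show ?thesis
        by (simp only: scaleR_fun_def real_scaleR_def sum_distrib_left sum_distrib_right)
    next
      case False
      then have out: "p m x = 0" for m using p_ell2 by (auto simp: ell2_def)
      then have "T f x = 0"
        unfolding T_def minus_apply mult_X_def proj_p proj_phat by (simp add: phat_even)
      then show ?thesis by (simp add: scaleR_fun_def out)
    qed
  qed

  have b: "b > 0"
    using P' nM sqrt_rec_coeff [of h "2 * n + 1"] by (simp add: b_def monic_OPs_def)
  have dim: "dim (T ` ell2_0 N) = 1"
  proof -
    \<comment> \<open>The factor \<open>y\<close> cancels the \<open>1 / y\<close> of the kernel, so that pairing with \<open>p\<^sub>2\<^sub>n\<^sub>+\<^sub>1\<close> gives its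
      norm; dividing by \<open>- b\<close> normalizes the image to \<open>p\<^sub>2\<^sub>n\<close>.\<close>
    define f where "f = (\<lambda>y. - (of_int y * p (2 * n + 1) y) / b)"
    have f: "f \<in> ell2_0 N"
      using p_ell2 [of "2 * n + 1"] by (auto simp: f_def ell2_0_def ell2_def)
    have p0: "p (2 * n + 1) 0 = 0"
      using odd_OP_at_0 [OF P' even_w nM] by (simp add: p orth_fun_def)
    have "- b * (\<Sum>y\<in>sites N - {0}. p (2 * n + 1) y / of_int y * f y)
        = (\<Sum>y\<in>sites N - {0}. p (2 * n + 1) y * p (2 * n + 1) y)"
      unfolding sum_distrib_left using b by (intro sum.cong) (auto simp: f_def)
    also have "\<dots> = ell2_inner N (p (2 * n + 1)) (p (2 * n + 1))"
      unfolding ell2_inner_def by (intro sum.mono_neutral_left) (use p0 in auto)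
    also have "\<dots> = 1" by (simp add: on)
    finally have "T f = p (2 * n)" by (simp add: T_rank1 [OF f])
    then have "p (2 * n) \<in> T ` ell2_0 N" using f by (metis image_eqI)
    moreover have "T ` ell2_0 N \<subseteq> span {p (2 * n)}"
    proof (rule image_subsetI)
      fix g assume "g \<in> ell2_0 N"
      then show "T g \<in> span {p (2 * n)}"
        unfolding T_rank1 [OF \<open>g \<in> ell2_0 N\<close>] by (intro span_scale span_base) simp
    qed
    ultimately have "span {p (2 * n)} = span (T ` ell2_0 N)"
      unfolding span_eq by (auto intro: span_base)
    moreover have "p (2 * n) \<noteq> 0"
      using on [of "2 * n" "2 * n"] by (auto simp: ell2_inner_def)
    then have "independent {p (2 * n)}"
      by (simp add: independent_insert)
    ultimately show ?thesis
      using dim_eq_card [of "{p (2 * n)}" "T ` ell2_0 N"] by simp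
  qed

  have simplified: "of_int x / (2 * of_int y) * ker1 phat n x y - 1 / 2 * ker0 p (n + 1) x y = K x y"
    if "w 0 = 0" for x y
  proof (cases "x = 0")
    case True
    \<comment> \<open>The factors \<open>1 / 2\<close> and \<open>1 / (2 * eta 0)\<close> differ here, but every \<open>p\<^sub>m\<close> has the factor \<open>sqrt (w 0) = 0\<close> there.\<close>
    then have "p m x = 0" for m using that by (simp add: p orth_fun_def)
    then show ?thesis by (simp add: K_def ker0_def True)
  qed (simp add: K_def eta_def)

  show ?thesis
    unfolding K_def [symmetric] T_def [symmetric] b_def [symmetric]
  proof (intro conjI ballI impI)
    fix x y assume xy: "x \<in> sites N" "y \<in> sites N - {0}"
    then show K: "K x y = - (b / of_int y) * p (2 * n) x * p (2 * n + 1) y"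
      by (simp only: K_rank1 Diff_iff singleton_iff simp_thms)
    then show "of_int x / (2 * of_int y) * ker1 phat n x y - 1 / 2 * ker0 p (n + 1) x y
        = - (b / of_int y) * p (2 * n) x * p (2 * n + 1) y" if "w 0 = 0"
      by (simp only: simplified [OF that])
  qed (use T_K dim in simp_all)
qed

end
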